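(* Let $\alpha>0$, let $n$ be the positive integer with $n-1<\alpha\le n$, let $a,b\in\mathbb{R}$, $a(\alpha)=a+n-1$ and $b(\alpha)=b-n+1$. (1) If $f$ is a real-valued function defined on $\mathbb{N}_a$, then for all $t\in\mathbb{N}_{a+n}$ $${}^{C}\nabla_{a(\alpha)}^\alpha f(t)=\nabla_{a(\alpha)}^\alpha f(t)-\sum_{k=0}^{n-1}\frac{(t-a(\alpha))^{\overline{k-\alpha}}}{\Gamma(k-\alpha+1)}\nabla^k f(a(\alpha)).$$ (2) If $f$ is a real-valued function defined on ${}_{b}\mathbb{N}$, then for all $t\in{}_{b-n}\mathbb{N}$ $${}_{b(\alpha)}^{C}\nabla^\alpha f(t)={}_{b(\alpha)}\nabla^\alpha f(t)-\sum_{k=0}^{n-1}\frac{(b(\alpha)-t)^{\overline{k-\alpha}}}{\Gamma(k-\alpha+1)}\,{}_{\ominus}\Delta^k f(b(\alpha)).$$ In particular, when $0<\alpha<1$, then $a(\alpha)=a$ and $b(\alpha)=b$ and hence $${}^{C}\nabla_a^\alpha f(t)=\nabla_a^\alpha f(t)-\frac{(t-a)^{\overline{-\alpha}}}{\Gamma(1-\alpha)}f(a)\quad\text{and}\quad {}_{b}^{C}\nabla^\alpha f(t)={}_{b}\nabla^\alpha f(t)-\frac{(b-t)^{\overline{-\alpha}}}{\Gamma(1-\alpha)}f(b).$$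
   Context: Notation: $\mathbb{N}_c=\{c,c+1,\dots\}$, ${}_{d}\mathbb{N}=\{d,d-1,\dots\}$; $\Delta f(t)=f(t+1)-f(t)$, $\nabla f(t)=f(t)-f(t-1)$, with $\Delta^m,\nabla^m$ their iterates; ${}_{\ominus}\Delta^m f(t)=(-1)^m\Delta^m f(t)$; $\rho(t)=t-1$. Rising function: $t^{\overline{\beta}}=\Gamma(t+\beta)/\Gamma(t)$. For $\nu>0$ and real $c,d$: the nabla left fractional sum is $\nabla_c^{-\nu}f(t)=\frac{1}{\Gamma(\nu)}\sum_{s=c+1}^{t}(t-\rho(s))^{\overline{\nu-1}}f(s)$ and the nabla right fractional sum is ${}_{d}\nabla^{-\nu}f(t)=\frac{1}{\Gamma(\nu)}\sum_{s=t}^{d-1}(s-\rho(t))^{\overline{\nu-1}}f(s)$. These are $0$ when the range of summation is empty ($t\le c$, resp. $t\ge d$). For $\nu=0$: $\nabla_c^{-0}f(t)=f(t)$ for $t\in\mathbb{N}_{c+1}$ and $0$ for $t\le c$; ${}_{d}\nabla^{-0}f(t)=f(t)$ for $t\in{}_{d-1}\mathbb{N}$ and $0$ for $t\ge d$. With $n-1<\alpha\le n$, the nabla (Riemann) fractional differences are $\nabla_c^\alpha f(t)=\nabla^n\big(\nabla_c^{-(n-\alpha)}f\big)(t)$, $t\in\mathbb{N}_{c+1}$, and ${}_{d}\nabla^\alpha f(t)={}_{\ominus}\Delta^n\big({}_{d}\nabla^{-(n-\alpha)}f\big)(t)$, $t\in{}_{d-1}\mathbb{N}$. The dual nabla Caputo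 fractional differences are ${}^{C}\nabla_{a(\alpha)}^\alpha f(t)=\nabla_{a(\alpha)}^{-(n-\alpha)}(\nabla^n f)(t)$, $t\in\mathbb{N}_{a+n}$, and ${}_{b(\alpha)}^{C}\nabla^\alpha f(t)={}_{b(\alpha)}\nabla^{-(n-\alpha)}({}_{\ominus}\Delta^n f)(t)$, $t\in{}_{b-n}\mathbb{N}$. Convention: for a positive integer $x$ and real $\beta$, the quotient $x^{\overline{\beta}}/\Gamma(\beta+1)=\Gamma(x+\beta)/(\Gamma(x)\Gamma(\beta+1))$ is read, when Gamma factors have poles, as its limiting value $\frac{1}{(x-1)!}\prod_{j=1}^{x-1}(\beta+j)$; in particular it is $0$ when only the denominator has a pole. *)

theory Defs
  imports "HOL-Analysis.Analysis"
begin

text \<open>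
  Functions on a discrete half-line are represented by total functions on the reals; the values
  elsewhere are irrelevant, because every expression below is only evaluated at points where it
  reads nothing outside that half-line.
\<close>

definition nats_up :: "real \<Rightarrow> real set" where
  "nats_up c = {c + real k |k. True}"

definition nats_down :: "real \<Rightarrow> real set" where
  "nats_down d = {d - real k |k. True}"

definition nabla :: "(real \<Rightarrow> real) \<Rightarrow> real \<Rightarrow> real" where
  "nabla f t = f t - f (t - 1)"

definition fdelta :: "(real \<Rightarrow> real) \<Rightarrow> real \<Rightarrow> real" where
  "fdelta f t = f (t + 1) - f t"

definition ominus_delta :: "nat \<Rightarrow> (real \<Rightarrow> real) \<Rightarrow> real \<Rightarrow> real" where
  "ominus_delta m f t = (- 1) ^ m * (fdelta ^^ m) f t"

definition rho :: "real \<Rightarrow> real" where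
  "rho t = t - 1"

definition rising :: "real \<Rightarrow> real \<Rightarrow> real" where
  "rising t \<beta> = Gamma (t + \<beta>) / Gamma t"

text \<open>
  The quotient of \<open>rising x \<beta>\<close> by \<open>Gamma (\<beta> + 1)\<close> for a positive integer \<open>x\<close>. A pole of the numerator
  \<open>Gamma (x + \<beta>)\<close> forces one of \<open>Gamma (\<beta> + 1)\<close>, so the first case covers all poles. There the
  library's junk values (\<open>Gamma = 0\<close> at poles, division by zero) would give \<open>0\<close>, and the limiting
  value is used instead; see \<open>rising_quot_eq_prod\<close> and \<open>rising_quot_limit\<close> below.
\<close>

definition rising_quot :: "real \<Rightarrow> real \<Rightarrow> real" where
  "rising_quot x \<beta> =
     (if \<beta> + 1 \<in> \<int>\<^sub>\<le>\<^sub>0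
      then (\<Prod>j\<in>{1..<nat \<lfloor>x\<rfloor>}. \<beta> + real j) / fact (nat \<lfloor>x\<rfloor> - 1)
      else rising x \<beta> / Gamma (\<beta> + 1))"

text \<open>
  Fractional sums of order \<open>\<nu> \<ge> 0\<close>. The summation runs over \<open>s = c + 1, c + 2, \<dots>, t\<close>, respectively
  \<open>s = t, t + 1, \<dots>, d - 1\<close>; the index set is empty for \<open>t \<le> c\<close>, respectively \<open>t \<ge> d\<close>.
\<close>

definition nabla_left_sum :: "real \<Rightarrow> real \<Rightarrow> (real \<Rightarrow> real) \<Rightarrow> real \<Rightarrow> real" where
  "nabla_left_sum c \<nu> f t =
     (if \<nu> = 0 then (if t \<in> nats_up (c + 1) then f t else 0)
      else 1 / Gamma \<nu> * (\<Sum>s\<in>{s \<in> nats_up (c + 1). s \<le> t}. rising (t - rho s) (\<nu> - 1) * f s))"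

definition nabla_right_sum :: "real \<Rightarrow> real \<Rightarrow> (real \<Rightarrow> real) \<Rightarrow> real \<Rightarrow> real" where
  "nabla_right_sum d \<nu> f t =
     (if \<nu> = 0 then (if t \<in> nats_down (d - 1) then f t else 0)
      else 1 / Gamma \<nu> * (\<Sum>s\<in>{s \<in> nats_down (d - 1). t \<le> s}. rising (s - rho t) (\<nu> - 1) * f s))"

text \<open>For \<open>\<alpha> > 0\<close>, the integer \<open>n\<close> with \<open>n - 1 < \<alpha> \<le> n\<close>.\<close>

definition frac_ord :: "real \<Rightarrow> nat" where
  "frac_ord \<alpha> = nat \<lceil>\<alpha>\<rceil>"

definition nabla_left_diff :: "real \<Rightarrow> real \<Rightarrow> (real \<Rightarrow> real) \<Rightarrow> real \<Rightarrow> real" where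
  "nabla_left_diff c \<alpha> f t =
     (nabla ^^ frac_ord \<alpha>) (nabla_left_sum c (real (frac_ord \<alpha>) - \<alpha>) f) t"

definition nabla_right_diff :: "real \<Rightarrow> real \<Rightarrow> (real \<Rightarrow> real) \<Rightarrow> real \<Rightarrow> real" where
  "nabla_right_diff d \<alpha> f t =
     ominus_delta (frac_ord \<alpha>) (nabla_right_sum d (real (frac_ord \<alpha>) - \<alpha>) f) t"

text \<open>
  The base point of the Caputo differences is the subscript written on the operator, that is the
  already shifted point \<open>a(\<alpha>) = a + n - 1\<close>, respectively \<open>b(\<alpha>) = b - n + 1\<close>.
\<close>

definition caputo_left_diff :: "real \<Rightarrow> real \<Rightarrow> (real \<Rightarrow> real) \<Rightarrow> real \<Rightarrow> real" where
  "caputo_left_diff c \<alpha> f t =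
     nabla_left_sum c (real (frac_ord \<alpha>) - \<alpha>) ((nabla ^^ frac_ord \<alpha>) f) t"

definition caputo_right_diff :: "real \<Rightarrow> real \<Rightarrow> (real \<Rightarrow> real) \<Rightarrow> real \<Rightarrow> real" where
  "caputo_right_diff d \<alpha> f t =
     nabla_right_sum d (real (frac_ord \<alpha>) - \<alpha>) (ominus_delta (frac_ord \<alpha>) f) t"

lemma frac_ord_eq:
  assumes "n > 0" "real n - 1 < \<alpha>" "\<alpha> \<le> real n"
  shows "frac_ord \<alpha> = n"
proof -
  have "\<lceil>\<alpha>\<rceil> = int n"
    using assms by (intro ceiling_unique) auto
  then show ?thesis
    by (simp add: frac_ord_def)
qed

lemma rising_quot_eq_prod:
  "rising_quot (real (Suc m)) \<beta> = (\<Prod>j\<in>{1..m}. \<beta> + real j) / fact m"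
proof -
  have eq: "{1..<Suc m} = {1..m}"
    by auto
  have fl: "nat \<lfloor>real (Suc m)\<rfloor> = Suc m"
    by (metis floor_of_nat nat_int)
  show ?thesis
  proof (cases "\<beta> + 1 \<in> \<int>\<^sub>\<le>\<^sub>0")
    case True
    then show ?thesis
      unfolding rising_quot_def fl eq by simp
  next
    case False
    have "(\<Prod>j\<in>{1..m}. \<beta> + real j) = pochhammer (\<beta> + 1) m"
      unfolding pochhammer_prod
      by (rule prod.reindex_bij_witness[of _ Suc "\<lambda>j. j - 1"]) (auto simp: algebra_simps)
    also have "\<dots> = Gamma (\<beta> + 1 + real m) / Gamma (\<beta> + 1)"
      using False by (rule pochhammer_Gamma)
    finally have "(\<Prod>j\<in>{1..m}. \<beta> + real j) = Gamma (\<beta> + 1 + real m) / Gamma (\<beta> + 1)" .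
    moreover have "Gamma (real (Suc m)) = fact m"
      using Gamma_fact[of m, where 'a = real] by (simp add: algebra_simps)
    ultimately show ?thesis
      using False by (simp add: rising_quot_def rising_def algebra_simps)
  qed
qed

lemma rising_quot_limit:
  "((\<lambda>\<gamma>. rising (real (Suc m)) \<gamma> / Gamma (\<gamma> + 1)) \<longlongrightarrow> rising_quot (real (Suc m)) \<beta>) (at \<beta>)"
proof -
  have "((\<lambda>\<gamma>. (\<Prod>j\<in>{1..m}. \<gamma> + real j) / fact m) \<longlongrightarrow> (\<Prod>j\<in>{1..m}. \<beta> + real j) / fact m) (at \<beta>)"
    by (intro tendsto_intros) auto
  moreover have "eventually (\<lambda>\<gamma>. \<gamma> + 1 \<notin> \<int>\<^sub>\<le>\<^sub>0) (at \<beta>)"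
  proof -
    have "\<forall>\<^sub>F \<gamma> in at \<beta>. \<gamma> \<in> - (\<int> - {\<beta>}) - {\<beta>}"
    proof (rule eventually_at_in_open)
      show "open (- (\<int> - {\<beta>}))"
        by (intro open_Compl closed_subset_Ints) auto
    qed auto
    then show ?thesis
    proof eventually_elim
      case (elim \<gamma>)
      then show ?case
        using nonpos_Ints_Int[of "\<gamma> + 1"] Ints_diff[of "\<gamma> + 1" 1] by auto
    qed
  qed
  then have "eventually (\<lambda>\<gamma>. (\<Prod>j\<in>{1..m}. \<gamma> + real j) / fact m
      = rising (real (Suc m)) \<gamma> / Gamma (\<gamma> + 1)) (at \<beta>)"
    by eventually_elim (simp only: rising_quot_eq_prod[symmetric], simp add: rising_quot_def)
  ultimately show ?thesis
    unfolding rising_quot_eq_prod by (rule Lim_transform_eventually)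
qed

end

theory Submission
  imports Defs
begin

text \<open>
  The left fractional sum from \<open>c\<close> is a discrete convolution: at \<open>c + m\<close> it is the sum of
  \<open>rising_quot (i + 1) (\<nu> - 1) * f (c + m - i)\<close> over \<open>i < m\<close>, and in this form the order \<open>\<nu> = 0\<close> is
  no exception, because the kernel then vanishes except at \<open>i = 0\<close>. The backward difference of a
  convolution falls on the factor \<open>f\<close>, up to a boundary term: the sum at \<open>t\<close> has one term more than
  the sum at \<open>t - 1\<close>, and in the sum of \<open>nabla f\<close> that last term also reads \<open>f c\<close>. The correction is
  \<open>f c\<close> times the kernel \<open>rising_quot (t - c) (\<nu> - 1)\<close> (\<open>nabla_left_sum_commute\<close>).

  The kernel, extended by zero to the left of \<open>c + 1\<close>, satisfies the power rule: its difference is the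
  kernel with the exponent lowered by one (\<open>nabla_power_kernel\<close>), which is Pascal's rule. So the
  boundary term left behind when the difference is applied for the \<open>(k + 1)\<close>-st time carries
  \<open>(nabla ^^ k) f c\<close>, and the \<open>n - 1 - k\<close> differences still to come lower its exponent from \<open>\<nu> - 1\<close> to \<open>\<nu> - n + k\<close>, that is
  \<open>k - \<alpha>\<close> for \<open>\<nu> = n - \<alpha>\<close>. Summing over \<open>k < n\<close> gives the left identity
  (\<open>caputo_left_diff_eq\<close>).

  The reflection \<open>t \<mapsto> - t\<close> exchanges left and right operators, so the right identity is the left one
  for \<open>\<lambda>x. f (- x)\<close>. For \<open>\<alpha> < 1\<close> only \<open>k = 0\<close> occurs, with exponent \<open>- \<alpha>\<close>, and no Gamma factor has a
  pole.
\<close>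

section \<open>The power kernel and Pascal's rule\<close>

text \<open>
  Extending by zero instead of leaving the values left of \<open>1\<close> unspecified makes the power rule hold at
  every point, including the first one, \<open>x = 1\<close>.
\<close>

definition power_kernel :: "real \<Rightarrow> real \<Rightarrow> real" where
  "power_kernel \<beta> x = (if x \<in> nats_up 1 then rising_quot x \<beta> else 0)"

lemma mem_nats_up_iff: "t \<in> nats_up (c + 1) \<longleftrightarrow> (\<exists>m. t = c + real (Suc m))"
  by (auto simp: nats_up_def algebra_simps)

lemma power_kernel_Suc: "power_kernel \<beta> (real (Suc m)) = pochhammer (\<beta> + 1) m / fact m"
proof -
  have "real (Suc m) \<in> nats_up 1"
    using mem_nats_up_iff[of "real (Suc m)" 0] by auto
  moreover have "(\<Prod>j\<in>{1..m}. \<beta> + real j) = pochhammer (\<beta> + 1) m"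
    unfolding pochhammer_prod
    by (rule prod.reindex_bij_witness[of _ Suc "\<lambda>j. j - 1"]) (auto simp: algebra_simps)
  ultimately show ?thesis
    unfolding power_kernel_def using rising_quot_eq_prod[of m \<beta>] by simp
qed

lemma power_kernel_eq_0: "x \<le> 0 \<Longrightarrow> power_kernel \<beta> x = 0"
  by (auto simp: power_kernel_def nats_up_def)

text \<open>
  This is Pascal's rule for \<open>pochhammer \<beta> m / fact m\<close>, which is the binomial coefficient
  \<open>\<beta> + m - 1\<close> over \<open>m\<close>. At \<open>x = 1\<close> it reads \<open>1 - 0 = 1\<close>, and where \<open>x\<close> is no positive integer,
  \<open>0 - 0 = 0\<close>.
\<close>

lemma nabla_power_kernel: "power_kernel \<beta> x - power_kernel \<beta> (x - 1) = power_kernel (\<beta> - 1) x"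
proof (cases "x \<in> nats_up 1")
  case False
  have "x - 1 \<notin> nats_up 1"
  proof
    assume "x - 1 \<in> nats_up 1"
    then obtain m where "x - 1 = 0 + real (Suc m)"
      using mem_nats_up_iff[of "x - 1" 0] by auto
    then have "x = 0 + real (Suc (Suc m))"
      by simp
    with False show False
      using mem_nats_up_iff[of x 0] by (metis add_0)
  qed
  with False show ?thesis
    by (simp add: power_kernel_def)
next
  case True
  then obtain m where x: "x = real (Suc m)"
    using mem_nats_up_iff[of x 0] by auto
  show ?thesis
  proof (cases m)
    case 0
    then show ?thesis
      using power_kernel_Suc[of \<beta> 0] power_kernel_Suc[of "\<beta> - 1" 0] 
      by (simp add: x power_kernel_eq_0)
  next
    case (Suc j)
    have "x - 1 = real (Suc j)"
      by (simp add: x Suc)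
    moreover have "pochhammer (\<beta> + 1) (Suc j) / fact (Suc j) - pochhammer (\<beta> + 1) j / fact j
        = pochhammer \<beta> (Suc j) / fact (Suc j)"
      unfolding pochhammer_Suc[of "\<beta> + 1"] pochhammer_rec[of \<beta>]
      by (simp add: divide_simps) (simp add: algebra_simps)
    ultimately show ?thesis
      using power_kernel_Suc[of \<beta> m] power_kernel_Suc[of "\<beta> - 1" m] power_kernel_Suc[of \<beta> j]
      by (simp add: x Suc)
  qed
qed

section \<open>Left fractional sums as convolutions\<close>

lemma nabla_left_sum_eq_0:
  assumes "t \<le> c"
  shows "nabla_left_sum c \<nu> f t = 0"
proof -
  have "{s \<in> nats_up (c + 1). s \<le> t} = {}" "t \<notin> nats_up (c + 1)"
    using assms by (auto simp: nats_up_def)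
  then show ?thesis
    unfolding nabla_left_sum_def by (simp only: sum.empty if_False mult_zero_right if_cancel)
qed

text \<open>
  The summation index counts backwards from \<open>t\<close>, so that the kernel factor of a term does not change
  with \<open>t\<close>.
\<close>

lemma nabla_left_sum_convolution:
  assumes "\<nu> \<ge> 0"
  shows "nabla_left_sum c \<nu> f (c + real m)
    = (\<Sum>i<m. power_kernel (\<nu> - 1) (real (Suc i)) * f (c + real m - real i))"
proof (cases "\<nu> = 0")
  case True
  have ker: "power_kernel (- 1) (real (Suc i)) = (if i = 0 then 1 else 0)" for i
    by (simp only: power_kernel_Suc) (simp add: pochhammer_0_left)
  have "c + real m \<in> nats_up (c + 1) \<longleftrightarrow> m > 0"
    unfolding mem_nats_up_iff gr0_conv_Suc add_left_cancel of_nat_eq_iff ..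
  moreover have "(\<Sum>i<m. power_kernel (- 1) (real (Suc i)) * f (c + real m - real i))
      = (if m > 0 then f (c + real m) else 0)"
    unfolding ker by (simp add: if_distrib[of "\<lambda>x. x * _"] sum.delta cong: if_cong)
  ultimately show ?thesis
    using True by (simp add: nabla_left_sum_def)
next
  case False
  then have pole: "\<nu> \<notin> \<int>\<^sub>\<le>\<^sub>0"
    using assms by (auto simp: nonpos_Ints_def)
  have "(\<Sum>s\<in>{s \<in> nats_up (c + 1). s \<le> c + real m}. rising (c + real m - rho s) (\<nu> - 1) * f s)
      = (\<Sum>i<m. rising (real (Suc i)) (\<nu> - 1) * f (c + real m - real i))"
  proof (rule sum.reindex_bij_witness[of _ "\<lambda>i. c + real m - real i"
        "\<lambda>s. nat \<lfloor>c + real m - s\<rfloor>"])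
    fix s assume "s \<in> {s \<in> nats_up (c + 1). s \<le> c + real m}"
    then obtain k where k: "s = c + real (Suc k)" "Suc k \<le> m"
      by (auto simp: mem_nats_up_iff)
    then have "c + real m - s = real (m - Suc k)"
      by (simp add: of_nat_diff)
    then have fl: "nat \<lfloor>c + real m - s\<rfloor> = m - Suc k"
      by (metis floor_of_nat nat_int)
    show "c + real m - real (nat \<lfloor>c + real m - s\<rfloor>) = s" "nat \<lfloor>c + real m - s\<rfloor> \<in> {..<m}"
      unfolding fl using k by (auto simp: of_nat_diff)
    show "rising (real (Suc (nat \<lfloor>c + real m - s\<rfloor>))) (\<nu> - 1)
        * f (c + real m - real (nat \<lfloor>c + real m - s\<rfloor>))
        = rising (c + real m - rho s) (\<nu> - 1) * f s"
      unfolding fl using k by (simp add: of_nat_diff rho_def algebra_simps)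
  next
    fix i assume i: "i \<in> {..<m}"
    have "c + real m - (c + real m - real i) = real i"
      by simp
    then show "nat \<lfloor>c + real m - (c + real m - real i)\<rfloor> = i"
      by (metis floor_of_nat nat_int)
    have "c + real m - real i = c + real (Suc (m - Suc i))"
      using i by (simp add: of_nat_diff)
    then have "c + real m - real i \<in> nats_up (c + 1)"
      unfolding mem_nats_up_iff by (rule exI)
    then show "c + real m - real i \<in> {s \<in> nats_up (c + 1). s \<le> c + real m}"
      by simp
  qed
  moreover have "power_kernel (\<nu> - 1) (real (Suc i))
      = rising (real (Suc i)) (\<nu> - 1) / Gamma \<nu>" for i
  proof -
    have "real (Suc i) \<in> nats_up 1"
      using mem_nats_up_iff[of "real (Suc i)" 0] by auto
    with pole show ?thesis
      by (simp add: power_kernel_def rising_quot_def del: of_nat_Suc)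
  qed
  ultimately show ?thesis
    using False by (simp add: nabla_left_sum_def sum_distrib_left del: of_nat_Suc)
qed

section \<open>Differences of left fractional sums\<close>

text \<open>
  With \<open>t = c + m + 1\<close>, the sum of \<open>nabla f\<close> at \<open>t\<close> subtracts \<open>m + 1\<close> terms where the sum of \<open>f\<close> at
  \<open>t - 1\<close> has \<open>m\<close>; the surplus term is the boundary term. Points \<open>t \<le> c\<close> are included because the
  iterated difference reaches back to them.
\<close>

lemma nabla_left_sum_commute:
  assumes "\<nu> \<ge> 0" and "t - c \<in> \<int>"
  shows "nabla (nabla_left_sum c \<nu> f) t
    = nabla_left_sum c \<nu> (nabla f) t + power_kernel (\<nu> - 1) (t - c) * f c"
proof (cases "t \<le> c")
  case True
  then show ?thesis
    by (simp add: nabla_def[of "nabla_left_sum c \<nu> f"] nabla_left_sum_eq_0 power_kernel_eq_0)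
next
  case False
  obtain i where i: "t - c = of_int i"
    using assms(2) by (auto elim: Ints_cases)
  with False have "i > 0"
    by (metis diff_gt_0_iff_gt not_le of_int_0_less_iff)
  then obtain m where "i = int (Suc m)"
    using gr0_implies_Suc[of "nat i"] by (metis nat_0_le order_less_imp_le zero_less_nat_eq)
  with i have t: "t = c + real (Suc m)" "t - 1 = c + real m" "t - c = real (Suc m)"
    by auto
  show ?thesis
    unfolding nabla_def[of "nabla_left_sum c \<nu> f"] t(2,3)
    unfolding t(1) nabla_left_sum_convolution[OF assms(1)]
    by (simp add: nabla_def algebra_simps sum_subtractf)
qed

lemma nabla_funpow_left_sum:
  assumes "\<nu> \<ge> 0" and "t - c \<in> \<int>"
  shows "(nabla ^^ n) (nabla_left_sum c \<nu> f) t
    = nabla_left_sum c \<nu> ((nabla ^^ n) f) t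
      + (\<Sum>k<n. power_kernel (\<nu> - real n + real k) (t - c) * (nabla ^^ k) f c)"
  using assms(2)
proof (induction n arbitrary: t)
  case 0
  then show ?case
    by simp
next
  case (Suc n)
  let ?S = "nabla_left_sum c \<nu>" and ?D = "\<lambda>k. (nabla ^^ k) f"
  have t1: "t - 1 - c \<in> \<int>"
    using Ints_diff[OF Suc.prems Ints_1] by (simp add: algebra_simps)
  have "(nabla ^^ Suc n) (?S f) t = (nabla ^^ n) (?S f) t - (nabla ^^ n) (?S f) (t - 1)"
    by (simp add: nabla_def)
  also have "\<dots> = nabla (?S (?D n)) t
      + (\<Sum>k<n. (power_kernel (\<nu> - real n + real k) (t - c)
                - power_kernel (\<nu> - real n + real k) (t - c - 1)) * ?D k c)"
    unfolding Suc.IH[OF Suc.prems] Suc.IH[OF t1]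
    by (simp add: nabla_def[of "?S (?D n)"] sum_subtractf left_diff_distrib algebra_simps)
  also have "\<dots> = ?S (?D (Suc n)) t + power_kernel (\<nu> - 1) (t - c) * ?D n c
      + (\<Sum>k<n. power_kernel (\<nu> - real n + real k - 1) (t - c) * ?D k c)"
    unfolding nabla_power_kernel nabla_left_sum_commute[OF assms(1) Suc.prems] by simp
  also have "\<dots> = ?S (?D (Suc n)) t
      + (\<Sum>k<Suc n. power_kernel (\<nu> - real (Suc n) + real k) (t - c) * ?D k c)"
    by (simp add: algebra_simps)
  finally show ?case .
qed

text \<open>Here the base point \<open>c\<close> is \<open>a(\<alpha>)\<close>.\<close>

lemma caputo_left_diff_eq:
  assumes "n > 0" and "real n - 1 < \<alpha>" and "\<alpha> \<le> real n" and "t \<in> nats_up (c + 1)"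
  shows "caputo_left_diff c \<alpha> f t = nabla_left_diff c \<alpha> f t
    - (\<Sum>k = 0..n - 1. rising_quot (t - c) (real k - \<alpha>) * (nabla ^^ k) f c)"
proof -
  obtain m where t: "t - c = real (Suc m)"
    using assms(4) by (auto simp: mem_nats_up_iff)
  then have "t - c \<in> nats_up 1" and lattice: "t - c \<in> \<int>"
    using mem_nats_up_iff[of "t - c" 0] by auto
  then have "power_kernel \<beta> (t - c) = rising_quot (t - c) \<beta>" for \<beta>
    by (simp add: power_kernel_def)
  moreover have "{0..n - 1} = {..<n}"
    using assms(1) by auto
  ultimately show ?thesis
    using nabla_funpow_left_sum[of "real n - \<alpha>" t c n f] assms(3) lattice
    by (simp add: caputo_left_diff_def nabla_left_diff_def frac_ord_eq[OF assms(1-3)])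
qed

section \<open>Reflection and the right operators\<close>

lemma nats_down_iff_reflect: "s \<in> nats_down d \<longleftrightarrow> - s \<in> nats_up (- d)"
  by (auto simp: nats_up_def nats_down_def algebra_simps)

lemma ominus_delta_reflect: "ominus_delta k f t = (nabla ^^ k) (\<lambda>x. f (- x)) (- t)"
proof (induction k arbitrary: t)
  case 0
  then show ?case
    by (simp add: ominus_delta_def)
next
  case (Suc k)
  have "ominus_delta (Suc k) f t = ominus_delta k f t - ominus_delta k f (t + 1)"
    by (simp add: ominus_delta_def fdelta_def algebra_simps)
  then show ?case
    by (simp add: Suc nabla_def)
qed

lemma nabla_right_sum_reflect:
  "nabla_right_sum d \<nu> f t = nabla_left_sum (- d) \<nu> (\<lambda>x. f (- x)) (- t)"
proof -
  have "(\<Sum>s\<in>{s \<in> nats_down (d - 1). t \<le> s}. rising (s - rho t) (\<nu> - 1) * f s)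
      = (\<Sum>s\<in>{s \<in> nats_up (- d + 1). s \<le> - t}. rising (- t - rho s) (\<nu> - 1) * f (- s))"
    by (rule sum.reindex_bij_witness[of _ uminus uminus])
      (auto simp: nats_down_iff_reflect rho_def algebra_simps)
  then show ?thesis
    by (simp add: nabla_right_sum_def nabla_left_sum_def nats_down_iff_reflect)
qed

lemma caputo_right_diff_reflect:
  "caputo_right_diff d \<alpha> f t = caputo_left_diff (- d) \<alpha> (\<lambda>x. f (- x)) (- t)"
  by (simp add: caputo_right_diff_def caputo_left_diff_def nabla_right_sum_reflect
      ominus_delta_reflect)

lemma nabla_right_diff_reflect:
  "nabla_right_diff d \<alpha> f t = nabla_left_diff (- d) \<alpha> (\<lambda>x. f (- x)) (- t)"
  by (simp add: nabla_right_diff_def nabla_left_diff_def nabla_right_sum_reflect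
      ominus_delta_reflect)

lemma caputo_right_diff_eq:
  assumes "n > 0" and "real n - 1 < \<alpha>" and "\<alpha> \<le> real n" and "t \<in> nats_down (d - 1)"
  shows "caputo_right_diff d \<alpha> f t = nabla_right_diff d \<alpha> f t
    - (\<Sum>k = 0..n - 1. rising_quot (d - t) (real k - \<alpha>) * ominus_delta k f d)"
  using caputo_left_diff_eq[OF assms(1-3), of "- t" "- d" "\<lambda>x. f (- x)"] assms(4)
  by (simp add: caputo_right_diff_reflect nabla_right_diff_reflect ominus_delta_reflect
      nats_down_iff_reflect)

section \<open>Caputo and Riemann fractional differences\<close>

theorem theorem5p5:
  fixes \<alpha> a b :: real and n :: nat
  assumes "\<alpha> > 0" and "n > 0" and "real n - 1 < \<alpha>" and "\<alpha> \<le> real n"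
  shows
    "(\<forall>f :: real \<Rightarrow> real. \<forall>t \<in> nats_up (a + real n).
        caputo_left_diff (a + real n - 1) \<alpha> f t =
          nabla_left_diff (a + real n - 1) \<alpha> f t
          - (\<Sum>k = 0..n - 1. rising_quot (t - (a + real n - 1)) (real k - \<alpha>)
                             * (nabla ^^ k) f (a + real n - 1)))
     \<and>
     (\<forall>f :: real \<Rightarrow> real. \<forall>t \<in> nats_down (b - real n).
        caputo_right_diff (b - real n + 1) \<alpha> f t =
          nabla_right_diff (b - real n + 1) \<alpha> f t
          - (\<Sum>k = 0..n - 1. rising_quot ((b - real n + 1) - t) (real k - \<alpha>)
                             * ominus_delta k f (b - real n + 1)))
     \<and>
     (\<alpha> < 1 \<longrightarrow>
        a + real n - 1 = a \<and> b - real n + 1 = b \<and>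
        (\<forall>f :: real \<Rightarrow> real. \<forall>t \<in> nats_up (a + 1).
           caputo_left_diff a \<alpha> f t =
             nabla_left_diff a \<alpha> f t - rising (t - a) (- \<alpha>) / Gamma (1 - \<alpha>) * f a) \<and>
        (\<forall>f :: real \<Rightarrow> real. \<forall>t \<in> nats_down (b - 1).
           caputo_right_diff b \<alpha> f t =
             nabla_right_diff b \<alpha> f t - rising (b - t) (- \<alpha>) / Gamma (1 - \<alpha>) * f b))"
proof (intro conjI allI ballI impI)
  fix f :: "real \<Rightarrow> real" and t
  assume "t \<in> nats_up (a + real n)"
  then show "caputo_left_diff (a + real n - 1) \<alpha> f t = nabla_left_diff (a + real n - 1) \<alpha> f t
      - (\<Sum>k = 0..n - 1. rising_quot (t - (a + real n - 1)) (real k - \<alpha>)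
          * (nabla ^^ k) f (a + real n - 1))"
    by (intro caputo_left_diff_eq assms) simp
next
  fix f :: "real \<Rightarrow> real" and t
  assume "t \<in> nats_down (b - real n)"
  then show "caputo_right_diff (b - real n + 1) \<alpha> f t = nabla_right_diff (b - real n + 1) \<alpha> f t
      - (\<Sum>k = 0..n - 1. rising_quot ((b - real n + 1) - t) (real k - \<alpha>)
          * ominus_delta k f (b - real n + 1))"
    by (intro caputo_right_diff_eq assms) simp
next
  assume "\<alpha> < 1"
  then have n: "n = 1"
    using assms by linarith
  then show "a + real n - 1 = a" "b - real n + 1 = b"
    by simp_all
  have "1 - \<alpha> \<notin> \<int>\<^sub>\<le>\<^sub>0"
    using \<open>\<alpha> < 1\<close> by (auto simp: nonpos_Ints_def)
  then have quot: "rising_quot x (- \<alpha>) = rising x (- \<alpha>) / Gamma (1 - \<alpha>)" for x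
    by (simp add: rising_quot_def)
  fix f :: "real \<Rightarrow> real" and t
  show "caputo_left_diff a \<alpha> f t
      = nabla_left_diff a \<alpha> f t - rising (t - a) (- \<alpha>) / Gamma (1 - \<alpha>) * f a"
    if "t \<in> nats_up (a + 1)"
    using caputo_left_diff_eq[OF assms(2-4) that] by (simp add: n quot)
  show "caputo_right_diff b \<alpha> f t
      = nabla_right_diff b \<alpha> f t - rising (b - t) (- \<alpha>) / Gamma (1 - \<alpha>) * f b"
    if "t \<in> nats_down (b - 1)"
    using caputo_right_diff_eq[OF assms(2-4) that] by (simp add: n quot ominus_delta_def)
qed

end
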